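(* Let $d\ge 3$, and let $\theta_0$ be the percolation function of the vacant set of random interlacements on $\mathbb{Z}^d$ and $\widehat{u}\in(0,u_*]$ the level defined in the context. Then the function $\theta_0$ is $C^1$ on $[0,\widehat{u})$, and its derivative $\theta_0'$ is positive on $[0,\widehat{u})$.
   Context: Let $d\ge 3$. For finite $K\subset\mathbb{Z}^d$, $\mathrm{cap}(K)$ denotes the capacity of $K$ for the simple random walk on $\mathbb{Z}^d$, normalized so that $\mathrm{cap}(\{0\})=1/g(0,0)$, where $g(\cdot,\cdot)$ is the Green function of the simple random walk on $\mathbb{Z}^d$. Under the probability $\mathbb{P}$, $\mathcal{I}^u$, $u\ge 0$, denotes the random interlacements at level $u$ on $\mathbb{Z}^d$ (increasing in $u$), and $\mathcal{V}^u=\mathbb{Z}^d\setminus\mathcal{I}^u$ the vacant set at level $u$; the law of $\mathcal{V}^u$ is characterized by $\mathbb{P}[K\subset\mathcal{V}^u]=e^{-u\,\mathrm{cap}(K)}$ for all finite $K\subset\mathbb{Z}^d$. Connectivity is nearest-neighbor connectivity in $\mathbb{Z}^d$. The percolation function is $\theta_0(u)=\mathbb{P}[0 \text{ does not belong to an infinite cluster of }\mathcal{V}^u]$, $u\ge 0$ (a cluster is a connected component of $\mathcal{V}^u$). The critical level $u_*\in(0,\infty)$ is such that $\theta_0=1$ on $(u_*,\infty)$ and $\theta_0<1$ on $(0,u_* )$ (it is known that such a $u_*$ exists). $B_L=\{x\in\mathbb{Z}^d: |x|_\infty\le L\}$ is the closed sup-norm ball with center $0$ and radius $L$, and $\partial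 B_L$ is its internal boundary, i.e. the set of sites of $B_L$ that are neighbors of $\mathbb{Z}^d\setminus B_L$. For $0\le\alpha<\beta<u_*$, one says that $\mathrm{NLF}(\alpha,\beta)$ holds if there exist $L_0(\alpha,\beta)\ge 1$, $c_0(\alpha,\beta)>0$, $\gamma(\alpha,\beta)\in(0,1]$ such that for all $L\ge L_0$ and $u\in[\alpha,\beta]$, $$\mathbb{P}[\,0\text{ is connected to }\partial B_L\text{ in }\mathcal{V}^u,\ 0\text{ does not belong to an infinite cluster of }\mathcal{V}^u\,]\le e^{-c_0L^\gamma}.$$ Set $\widehat{u}=\sup\{u\in[0,u_* ):\ \mathrm{NLF}(0,u)\text{ holds}\}$; it is known that $\widehat{u}\in(0,u_*]$. At the endpoint $0$, derivatives are understood as one-sided (right) derivatives. *)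

theory Defs
  imports "HOL-Probability.Probability"
begin

section \<open>The lattice $\mathbb{Z}^d$\<close>

definition l1_norm :: "int ^ 'd \<Rightarrow> int" where
  "l1_norm x = (\<Sum>i\<in>UNIV. \<bar>x $ i\<bar>)"

definition sup_norm :: "int ^ 'd \<Rightarrow> int" where
  "sup_norm x = Max (range (\<lambda>i. \<bar>x $ i\<bar>))"

definition nn :: "int ^ 'd \<Rightarrow> int ^ 'd \<Rightarrow> bool" where
  "nn x y \<longleftrightarrow> l1_norm (x - y) = 1"

definition sup_ball :: "real \<Rightarrow> (int ^ 'd) set" where
  "sup_ball L = {x. real_of_int (sup_norm x) \<le> L}"

definition inner_boundary :: "(int ^ 'd) set \<Rightarrow> (int ^ 'd) set" where
  "inner_boundary B = {x \<in> B. \<exists>y. y \<notin> B \<and> nn x y}"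

definition connected_in :: "(int ^ 'd) set \<Rightarrow> int ^ 'd \<Rightarrow> int ^ 'd \<Rightarrow> bool" where
  "connected_in V x y \<longleftrightarrow>
     x \<in> V \<and> (x, y) \<in> {(a, b). a \<in> V \<and> b \<in> V \<and> nn a b}\<^sup>*"

text \<open>The cluster of \<open>x\<close> in \<open>V\<close>; it is empty when \<open>x\<close> is not in \<open>V\<close>.\<close>

definition cluster :: "(int ^ 'd) set \<Rightarrow> int ^ 'd \<Rightarrow> (int ^ 'd) set" where
  "cluster V x = {y. connected_in V x y}"

section \<open>Simple random walk and capacity\<close>

definition unit_steps :: "(int ^ 'd) set" where
  "unit_steps = {e. l1_norm e = 1}"

lemma finite_unit_steps: "finite (unit_steps :: (int ^ 'd) set)"
proof -
  have "unit_steps \<subseteq> vec_lambda ` (UNIV \<rightarrow>\<^sub>E {-1..1::int} :: ('d \<Rightarrow> int) set)"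
  proof
    fix e :: "int ^ 'd"
    assume "e \<in> unit_steps"
    then have s: "(\<Sum>i\<in>UNIV. \<bar>e $ i\<bar>) = 1"
      by (simp add: unit_steps_def l1_norm_def)
    have "\<bar>e $ i\<bar> \<le> 1" for i
      using member_le_sum[of i UNIV "\<lambda>i. \<bar>e $ i\<bar>"] s by simp
    then have "vec_nth e \<in> UNIV \<rightarrow>\<^sub>E {-1..1}"
      by (auto simp: abs_le_iff)
    then show "e \<in> vec_lambda ` (UNIV \<rightarrow>\<^sub>E {-1..1})"
      by (metis image_eqI vec_nth_inverse)
  qed
  then show ?thesis
    by (rule finite_subset) (auto intro!: finite_imageI finite_PiE)
qed

lemma unit_steps_nonempty: "unit_steps \<noteq> ({} :: (int ^ 'd) set)"
proof -
  have "(axis undefined 1 :: int ^ 'd) \<in> unit_steps"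
    by (simp add: unit_steps_def l1_norm_def axis_def if_distrib sum.If_cases)
  then show ?thesis by blast
qed

definition srw_steps :: "(nat \<Rightarrow> int ^ 'd) measure" where
  "srw_steps = PiM UNIV (\<lambda>_. measure_pmf (pmf_of_set unit_steps))"

definition srw :: "int ^ 'd \<Rightarrow> (nat \<Rightarrow> int ^ 'd) \<Rightarrow> nat \<Rightarrow> int ^ 'd" where
  "srw x \<xi> n = x + (\<Sum>k<n. \<xi> k)"

text \<open>The probability that the walk started at \<open>x\<close> is never in \<open>K\<close> at a positive time.
  For \<open>x \<in> K\<close> this is the mass at \<open>x\<close> of the equilibrium measure of \<open>K\<close>.\<close>

definition escape_prob :: "(int ^ 'd) set \<Rightarrow> int ^ 'd \<Rightarrow> real" where
  "escape_prob K x =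
     measure srw_steps {\<xi> \<in> space srw_steps. \<forall>n\<ge>1. srw x \<xi> n \<notin> K}"

text \<open>The total mass of the equilibrium measure.  In particular \<open>cap {0}\<close> is the
  probability of no return to the origin, that is \<open>1 / g(0,0)\<close>, since the number of
  visits to the origin is geometrically distributed.\<close>

definition cap :: "(int ^ 'd) set \<Rightarrow> real" where
  "cap K = (\<Sum>x\<in>K. escape_prob K x)"

section \<open>Random interlacements\<close>

definition vacant :: "(real \<Rightarrow> 'w \<Rightarrow> (int ^ 'd) set) \<Rightarrow> real \<Rightarrow> 'w \<Rightarrow> (int ^ 'd) set" where
  "vacant I u \<omega> = - I u \<omega>"

text \<open>Only levels \<open>u \<ge> 0\<close> are constrained; the values of \<open>I\<close> at negative levels are
  irrelevant.\<close>

locale random_interlacements = prob_space M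
  for M :: "'w measure" +
  fixes I :: "real \<Rightarrow> 'w \<Rightarrow> (int ^ 'd) set"
  assumes measurable_site: "0 \<le> u \<Longrightarrow> {\<omega> \<in> space M. x \<in> I u \<omega>} \<in> sets M"
    and increasing: "0 \<le> u \<Longrightarrow> u \<le> v \<Longrightarrow> \<omega> \<in> space M \<Longrightarrow> I u \<omega> \<subseteq> I v \<omega>"
    and vacant_law: "0 \<le> u \<Longrightarrow> finite K \<Longrightarrow>
      prob {\<omega> \<in> space M. K \<subseteq> vacant I u \<omega>} = exp (- u * cap K)"

definition theta0 :: "'w measure \<Rightarrow> (real \<Rightarrow> 'w \<Rightarrow> (int ^ 'd) set) \<Rightarrow> real \<Rightarrow> real" where
  "theta0 M I u =
     measure M {\<omega> \<in> space M. \<not> infinite (cluster (vacant I u \<omega>) 0)}"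

definition critical_level ::
    "'w measure \<Rightarrow> (real \<Rightarrow> 'w \<Rightarrow> (int ^ 'd) set) \<Rightarrow> real \<Rightarrow> bool" where
  "critical_level M I u_star \<longleftrightarrow> 0 < u_star \<and>
     (\<forall>u. u_star < u \<longrightarrow> theta0 M I u = 1) \<and>
     (\<forall>u. 0 < u \<and> u < u_star \<longrightarrow> theta0 M I u < 1)"

definition NLF ::
    "'w measure \<Rightarrow> (real \<Rightarrow> 'w \<Rightarrow> (int ^ 'd) set) \<Rightarrow> real \<Rightarrow> real \<Rightarrow> bool" where
  "NLF M I \<alpha> \<beta> \<longleftrightarrow>
     (\<exists>L\<^sub>0 c\<^sub>0 \<gamma>. L\<^sub>0 \<ge> 1 \<and> c\<^sub>0 > 0 \<and> 0 < \<gamma> \<and> \<gamma> \<le> 1 \<and>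
       (\<forall>L\<ge>L\<^sub>0. \<forall>u\<in>{\<alpha>..\<beta>}.
          measure M {\<omega> \<in> space M.
            (\<exists>y\<in>inner_boundary (sup_ball L). connected_in (vacant I u \<omega>) 0 y) \<and>
            \<not> infinite (cluster (vacant I u \<omega>) 0)}
          \<le> exp (- c\<^sub>0 * L powr \<gamma>)))"

text \<open>The set contains \<open>u = 0\<close>, where the vacant set is almost surely the whole lattice,
  so for \<open>u_star > 0\<close> the supremum is over a nonempty bounded set.\<close>

definition u_hat ::
    "'w measure \<Rightarrow> (real \<Rightarrow> 'w \<Rightarrow> (int ^ 'd) set) \<Rightarrow> real \<Rightarrow> real" where
  "u_hat M I u_star = Sup {u. 0 \<le> u \<and> u < u_star \<and> NLF M I 0 u}"

end

theory Submission
  imports Defs "HOL-Real_Asymp.Real_Asymp"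
begin

text \<open>Let \<open>F\<^sub>n(u)\<close> be the probability that the origin is connected to the boundary of the box of
  radius \<open>n\<close> within the vacant part of the box at level \<open>u\<close>.  On \<open>[0, \<beta>]\<close>, where
  \<open>NLF(0, \<beta>)\<close> holds, \<open>F\<^sub>n\<close> approximates \<open>1 - \<theta>\<^sub>0\<close> uniformly up to a stretched exponential
  error.  Each \<open>F\<^sub>n\<close> is a finite linear combination of functions \<open>exp (- u cap(K))\<close>, hence
  smooth, but the number of terms is huge, so that the derivatives need a different bound.

  It comes from infinite divisibility.  As a function of the level, the trace of the interlacement
  on the box \<open>B\<close> has the one-dimensional laws of a Markov process that starts from the empty set
  and takes the union with \<open>C\<close> at some rate \<open>\<nu>(C)\<close>.  Moebius inversion of the capacity produces
  the weights \<open>\<nu>\<close>, the identity for vacancy indicators extends by linearity to all functions of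
  the trace (\<open>mean_has_derivative\<close>), and \<open>\<nu>(C) \<ge> 0\<close> for nonempty \<open>C\<close> because \<open>\<nu>(C)\<close> is the
  derivative at \<open>u = 0\<close> of a probability that starts from \<open>0\<close> (\<open>jump_rate_nonneg\<close>).  The total
  rate is \<open>cap(B)\<close>, so each derivative in \<open>u\<close> costs a factor of at most \<open>2 cap(B)\<close>, which is
  polynomial in \<open>n\<close>.

  By interpolation, a function that is stretched-exponentially small and has a second derivative
  of polynomial size has a stretched-exponentially small first derivative.  Applied to
  \<open>F\<^sub>n\<^sub>+\<^sub>1 - F\<^sub>n\<close> this makes the \<open>F\<^sub>n'\<close> converge uniformly on \<open>[0, \<beta>]\<close>, so that \<open>\<theta>\<^sub>0\<close> is
  continuously differentiable there (\<open>C1_limit_of_fast_convergence\<close>).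

  For the positivity, a jump never creates a connection, and a jump that covers the origin
  destroys all connections from it.  Such jumps have total rate \<open>cap({0})\<close>, hence
  \<open>- F\<^sub>n' \<ge> cap({0}) F\<^sub>n\<close> (\<open>mean_generator_le\<close>) and in the limit
  \<open>\<theta>\<^sub>0' \<ge> cap({0}) (1 - \<theta>\<^sub>0)\<close>.  Here \<open>1 - \<theta>\<^sub>0 > 0\<close> below the critical level, and
  \<open>cap({0}) > 0\<close>, since otherwise the vacant set would almost surely be the whole lattice at every level
  (\<open>cap_origin_pos\<close>).\<close>

section \<open>Infinitely divisible random subsets of a finite set\<close>

text \<open>Moebius inversion over the subsets of a finite set.  When \<open>x\<close> joins the ground set, the
  weights of the sets that contain \<open>x\<close> have to account for the increment
  \<open>g (insert x S) - g S\<close>.\<close>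

lemma subset_sum_inversion:
  fixes g :: "'a set \<Rightarrow> real"
  assumes "finite B"
  shows "\<exists>\<nu>. \<forall>S\<subseteq>B. (\<Sum>A\<in>Pow S. \<nu> A) = g S"
  using assms
proof (induction B arbitrary: g rule: finite_induct)
  case empty
  then show ?case
    by (intro exI[of _ g]) auto
next
  case (insert x B)
  obtain \<nu> where \<nu>: "\<And>S. S \<subseteq> B \<Longrightarrow> (\<Sum>A\<in>Pow S. \<nu> A) = g S"
    using insert.IH[of g] by blast
  obtain \<mu> where \<mu>: "\<And>S. S \<subseteq> B \<Longrightarrow> (\<Sum>A\<in>Pow S. \<mu> A) = g (insert x S) - g S"
    using insert.IH[of "\<lambda>S. g (insert x S) - g S"] by blast
  define \<rho> where "\<rho> A = (if x \<in> A then \<mu> (A - {x}) else \<nu> A)" for A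
  have without: "(\<Sum>A\<in>Pow S. \<rho> A) = g S" if "S \<subseteq> B" for S
    unfolding \<nu>[OF that, symmetric]
    by (rule sum.cong) (use that insert.hyps in \<open>auto simp: \<rho>_def\<close>)
  have "(\<Sum>A\<in>Pow S. \<rho> A) = g S" if S: "S \<subseteq> insert x B" for S
  proof (cases "x \<in> S")
    case False
    then show ?thesis using without[of S] S by blast
  next
    case True
    define T where "T = S - {x}"
    have T: "T \<subseteq> B" "x \<notin> T" "S = insert x T" "finite T"
      using True S insert.hyps by (auto simp: T_def intro: finite_subset)
    have inj: "inj_on (insert x) (Pow T)"
      using T(2) by (auto simp: inj_on_def)
    have "(\<Sum>A\<in>Pow S. \<rho> A) = (\<Sum>A\<in>Pow T. \<rho> A) + (\<Sum>A\<in>insert x ` Pow T. \<rho> A)"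
      unfolding T(3) Pow_insert using T by (intro sum.union_disjoint) auto
    also have "(\<Sum>A\<in>insert x ` Pow T. \<rho> A) = (\<Sum>A\<in>Pow T. \<mu> A)"
      unfolding sum.reindex[OF inj] o_def
      by (rule sum.cong) (use T in \<open>auto simp: \<rho>_def intro!: arg_cong[of _ _ \<mu>]\<close>)
    finally show ?thesis
      using without[OF T(1)] \<mu>[OF T(1)] T(3) by simp
  qed
  then show ?case by blast
qed

text \<open>Vacancy indicators span all functions on the subsets of \<open>B\<close>: they are closed under
  products, and the occupation indicator of a site is \<open>1\<close> minus a vacancy indicator, so
  point indicators are obtained by adding the occupied sites one at a time.\<close>

lemma vacancy_indicators_span:
  fixes f :: "'a set \<Rightarrow> real"
  assumes "finite B"
    and cong: "\<And>f g. Q f \<Longrightarrow> (\<And>A. A \<subseteq> B \<Longrightarrow> f A = g A) \<Longrightarrow> Q g"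
    and vac: "\<And>K. K \<subseteq> B \<Longrightarrow> Q (\<lambda>A. of_bool (A \<inter> K = {}))"
    and add: "\<And>f g. Q f \<Longrightarrow> Q g \<Longrightarrow> Q (\<lambda>A. f A + g A)"
    and scale: "\<And>f r. Q f \<Longrightarrow> Q (\<lambda>A. r * f A)"
  shows "Q f"
proof -
  have mixed: "Q (\<lambda>A. of_bool (S \<subseteq> A \<and> A \<inter> K = {}))"
    if "finite S" "S \<subseteq> B" "K \<subseteq> B" for S K
    using that
  proof (induction S arbitrary: K rule: finite_induct)
    case empty
    then show ?case using vac[of K] by simp
  next
    case (insert x S)
    have "Q (\<lambda>A. of_bool (S \<subseteq> A \<and> A \<inter> K = {}) +
        (- 1) * of_bool (S \<subseteq> A \<and> A \<inter> insert x K = {}))"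
      using insert.prems by (intro add scale insert.IH) auto
    then show ?case
      by (rule cong) auto
  qed
  have zero: "Q (\<lambda>A. 0)"
    using scale[of "\<lambda>A. of_bool (A \<inter> {} = {})" 0] vac[of "{}"] by simp
  have "Q (\<lambda>A. \<Sum>S\<in>\<S>. f S * of_bool (S \<subseteq> A \<and> A \<inter> (B - S) = {}))"
    if "finite \<S>" "\<S> \<subseteq> Pow B" for \<S>
    using that
  proof (induction \<S> rule: finite_induct)
    case empty
    then show ?case using zero by simp
  next
    case (insert S \<S>)
    have "Q (\<lambda>A. f S * of_bool (S \<subseteq> A \<and> A \<inter> (B - S) = {}) +
        (\<Sum>S\<in>\<S>. f S * of_bool (S \<subseteq> A \<and> A \<inter> (B - S) = {})))"
      using insert assms(1) by (intro add scale mixed) (auto intro: finite_subset)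
    then show ?case
      by (simp only: sum.insert[OF insert.hyps])
  qed
  then have "Q (\<lambda>A. \<Sum>S\<in>Pow B. f S * of_bool (S \<subseteq> A \<and> A \<inter> (B - S) = {}))"
    using assms(1) by blast
  then show ?thesis
  proof (rule cong)
    fix A assume "A \<subseteq> B"
    have "(\<Sum>S\<in>Pow B. f S * of_bool (S \<subseteq> A \<and> A \<inter> (B - S) = {})) =
        (\<Sum>S\<in>Pow B. if S = A then f S else 0)"
      by (rule sum.cong) (use \<open>A \<subseteq> B\<close> in auto)
    also have "\<dots> = f A"
      using \<open>A \<subseteq> B\<close> assms(1) by simp
    finally show "(\<Sum>S\<in>Pow B. f S * of_bool (S \<subseteq> A \<and> A \<inter> (B - S) = {})) = f A" .
  qed
qed

text \<open>Here \<open>p A u\<close> is the probability that the random set at level \<open>u\<close> has trace \<open>A\<close>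
  on \<open>B\<close>, so that \<open>vacancy\<close> is the law of interlacements seen in the window \<open>B\<close>.\<close>

locale exponential_vacancy =
  fixes B :: "'a set" and p :: "'a set \<Rightarrow> real \<Rightarrow> real" and c :: "'a set \<Rightarrow> real"
  assumes finite_window: "finite B"
    and nonneg: "A \<subseteq> B \<Longrightarrow> 0 \<le> u \<Longrightarrow> 0 \<le> p A u"
    and vacancy: "K \<subseteq> B \<Longrightarrow> 0 \<le> u \<Longrightarrow> (\<Sum>A\<in>Pow (B - K). p A u) = exp (- u * c K)"
    and c_empty: "c {} = 0"
begin

definition mean :: "('a set \<Rightarrow> real) \<Rightarrow> real \<Rightarrow> real" where
  "mean f u = (\<Sum>A\<in>Pow B. f A * p A u)"

text \<open>On the subsets of \<open>B\<close>, the unique signed weights such that the sets that avoid \<open>K\<close> have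
  total mass \<open>- c K\<close>, as the differentiation of \<open>vacancy\<close> at level \<open>0\<close> requires.  Away
  from \<open>{}\<close> they are the intensities with which a set is added to the random set.\<close>

definition jump_rate :: "'a set \<Rightarrow> real" where
  "jump_rate = (SOME \<nu>. \<forall>S\<subseteq>B. (\<Sum>C\<in>Pow S. \<nu> C) = - c (B - S))"

text \<open>The generator of the Markov process that takes the union with \<open>C\<close> at rate
  \<open>jump_rate C\<close>; the rate of \<open>{}\<close> makes the total mass zero and so accounts for the loss
  term.\<close>

definition generator :: "('a set \<Rightarrow> real) \<Rightarrow> 'a set \<Rightarrow> real" where
  "generator f A = (\<Sum>C\<in>Pow B. jump_rate C * f (A \<union> C))"

lemma sum_jump_rate: "K \<subseteq> B \<Longrightarrow> (\<Sum>C\<in>Pow (B - K). jump_rate C) = - c K"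
  using someI_ex[OF subset_sum_inversion[OF finite_window, of "\<lambda>S. - c (B - S)"]]
  by (fold jump_rate_def) (metis Diff_subset double_diff order_refl)

lemma sum_avoiding:
  "(\<Sum>A\<in>Pow B. w A * of_bool (A \<inter> K = {})) = (\<Sum>A\<in>Pow (B - K). w A :: real)"
  by (rule sum.mono_neutral_cong_right) (use finite_window in auto)

lemma total_mass: "0 \<le> u \<Longrightarrow> (\<Sum>A\<in>Pow B. p A u) = 1"
  using vacancy[of "{}" u] c_empty by simp

lemma mean_vacancy:
  assumes "K \<subseteq> B" "0 \<le> u"
  shows "mean (\<lambda>A. of_bool (A \<inter> K = {})) u = exp (- u * c K)"
  using vacancy[OF assms] sum_avoiding[of "\<lambda>A. p A u" K]
  by (simp add: mean_def mult.commute)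

lemma mean_cong: "(\<And>A. A \<subseteq> B \<Longrightarrow> f A = g A) \<Longrightarrow> mean f = mean g"
  unfolding mean_def by (intro ext sum.cong) auto

lemma mean_add: "mean (\<lambda>A. f A + g A) u = mean f u + mean g u"
  by (simp add: mean_def sum.distrib algebra_simps)

lemma mean_scale: "mean (\<lambda>A. r * f A) u = r * mean f u"
  by (simp add: mean_def sum_distrib_left algebra_simps)

lemma mean_mono:
  assumes "0 \<le> u" "\<And>A. A \<subseteq> B \<Longrightarrow> f A \<le> g A"
  shows "mean f u \<le> mean g u"
  unfolding mean_def using assms nonneg by (intro sum_mono mult_right_mono) auto

lemma abs_mean_le:
  assumes "0 \<le> u" "\<And>A. A \<subseteq> B \<Longrightarrow> \<bar>f A\<bar> \<le> m"
  shows "\<bar>mean f u\<bar> \<le> m"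
proof -
  have "\<bar>mean f u\<bar> \<le> (\<Sum>A\<in>Pow B. \<bar>f A * p A u\<bar>)"
    unfolding mean_def by (rule sum_abs)
  also have "\<dots> \<le> (\<Sum>A\<in>Pow B. m * p A u)"
    using assms nonneg by (intro sum_mono) (auto simp: abs_mult intro!: mult_right_mono)
  also have "\<dots> = m"
    using total_mass[OF assms(1)] by (simp flip: sum_distrib_left)
  finally show ?thesis .
qed

text \<open>For a vacancy indicator this is the derivative of \<open>exp (- u * c K)\<close>, since the
  vacancy of \<open>A \<union> C\<close> factorizes.  Both sides are linear in \<open>f\<close>.\<close>

lemma mean_has_derivative:
  assumes "0 \<le> u"
  shows "(mean f has_real_derivative mean (generator f) u) (at u within {0..})"
proof -
  define Q where "Q f \<longleftrightarrow>
    (\<forall>u\<ge>0. (mean f has_real_derivative mean (generator f) u) (at u within {0..}))" for f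
  have "Q f"
  proof (rule vacancy_indicators_span[OF finite_window])
    fix f g :: "'a set \<Rightarrow> real"
    assume "Q f" and eq: "\<And>A. A \<subseteq> B \<Longrightarrow> f A = g A"
    have "mean (generator f) = mean (generator g)"
      by (rule mean_cong) (auto simp: generator_def eq intro!: sum.cong)
    with \<open>Q f\<close> mean_cong[of f g, OF eq] show "Q g"
      by (simp add: Q_def)
  next
    fix K assume K: "K \<subseteq> B"
    let ?v = "\<lambda>A. of_bool (A \<inter> K = {}) :: real"
    have "generator ?v A = - c K * ?v A" for A
    proof -
      have "generator ?v A = (\<Sum>C\<in>Pow B. jump_rate C * ?v C) * ?v A"
        unfolding generator_def sum_distrib_right
        by (rule sum.cong) (auto simp: Int_Un_distrib2)
      then show ?thesis
        using sum_avoiding[of jump_rate K] sum_jump_rate[OF K] by simp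
    qed
    then have gen: "mean (generator ?v) u = - c K * mean ?v u" for u
      unfolding mean_scale[symmetric] by presburger
    show "Q ?v"
      unfolding Q_def
    proof (intro allI impI)
      fix u :: real assume u: "0 \<le> u"
      have "((\<lambda>u. exp (- u * c K)) has_real_derivative - c K * exp (- u * c K))
          (at u within {0..})"
        by (auto intro!: derivative_eq_intros)
      then have "(mean ?v has_real_derivative - c K * exp (- u * c K)) (at u within {0..})"
        by (rule has_field_derivative_transform_within[OF _ zero_less_one])
          (use u K in \<open>auto simp: mean_vacancy\<close>)
      then show "(mean ?v has_real_derivative mean (generator ?v) u) (at u within {0..})"
        using u K by (simp add: gen mean_vacancy)
    qed
  next
    fix f g assume "Q f" "Q g"
    moreover have "generator (\<lambda>A. f A + g A) = (\<lambda>A. generator f A + generator g A)"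
      by (auto simp: generator_def sum.distrib algebra_simps)
    moreover have "mean (\<lambda>A. f A + g A) = (\<lambda>u. mean f u + mean g u)" for f g
      by (simp add: mean_add fun_eq_iff)
    ultimately show "Q (\<lambda>A. f A + g A)"
      by (auto simp: Q_def intro!: DERIV_add)
  next
    fix f r assume "Q f"
    moreover have "generator (\<lambda>A. r * f A) = (\<lambda>A. r * generator f A)"
      by (auto simp: generator_def sum_distrib_left algebra_simps)
    moreover have "mean (\<lambda>A. r * f A) = (\<lambda>u. r * mean f u)" for f
      by (simp add: mean_scale fun_eq_iff)
    ultimately show "Q (\<lambda>A. r * f A)"
      by (auto simp: Q_def intro!: DERIV_cmult)
  qed
  with assms show ?thesis
    by (simp add: Q_def)
qed

lemma initially_empty:
  assumes "A \<subseteq> B"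
  shows "p A 0 = of_bool (A = {})"
proof -
  have "p {} 0 = 1"
    using vacancy[of B 0] by simp
  moreover have "(\<Sum>A\<in>Pow B. p A 0) = p {} 0 + (\<Sum>A\<in>Pow B - {{}}. p A 0)"
    using finite_window by (intro sum.remove) auto
  ultimately have "(\<Sum>A\<in>Pow B - {{}}. p A 0) = 0"
    using total_mass[of 0] by simp
  then have "\<forall>A\<in>Pow B - {{}}. p A 0 = 0"
    using nonneg finite_window by (subst (asm) sum_nonneg_eq_0_iff) auto
  with \<open>p {} 0 = 1\<close> assms show ?thesis
    by auto
qed

text \<open>The rate of \<open>C\<close> is the derivative at level \<open>0\<close> of the probability of the trace \<open>C\<close>,
  and this probability vanishes at \<open>0\<close> and is nonnegative afterwards.\<close>

lemma jump_rate_nonneg: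
  assumes C: "C \<subseteq> B" "C \<noteq> {}"
  shows "0 \<le> jump_rate C"
proof -
  let ?e = "\<lambda>A. of_bool (A = C) :: real"
  have mean_e: "mean ?e u = p C u" for u
    using finite_window C by (simp add: mean_def)
  have "mean (generator ?e) 0 = (\<Sum>A\<in>Pow B. if A = {} then generator ?e A else 0)"
    unfolding mean_def using initially_empty by (intro sum.cong) auto
  also have "\<dots> = jump_rate C"
    using finite_window C by (simp add: generator_def)
  finally have "(mean ?e has_real_derivative jump_rate C) (at 0 within {0..})"
    using mean_has_derivative[of 0 ?e] by simp
  then have "((\<lambda>u. (mean ?e u - mean ?e 0) / (u - 0)) \<longlongrightarrow> jump_rate C) (at 0 within {0..})"
    by (simp add: has_field_derivative_iff)
  then show ?thesis
  proof (rule tendsto_lowerbound)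
    show "eventually (\<lambda>u. 0 \<le> (mean ?e u - mean ?e 0) / (u - 0)) (at 0 within {0..})"
      using C nonneg[of C] initially_empty[of C]
      by (auto simp: eventually_at_filter mean_e)
    show "at 0 within {0..} \<noteq> (bot :: real filter)"
      by (simp add: at_within_Ici_at_right)
  qed
qed

lemma jump_rate_empty: "jump_rate {} = - c B"
  using sum_jump_rate[of B] by simp

lemma sum_positive_rates: "(\<Sum>C\<in>Pow B - {{}}. jump_rate C) = c B"
proof -
  have "(\<Sum>C\<in>Pow B. jump_rate C) = jump_rate {} + (\<Sum>C\<in>Pow B - {{}}. jump_rate C)"
    using finite_window by (intro sum.remove) auto
  then show ?thesis
    using sum_jump_rate[of "{}"] by (simp add: jump_rate_empty c_empty)
qed

lemma abs_generator_le:
  assumes f: "\<And>A. A \<subseteq> B \<Longrightarrow> \<bar>f A\<bar> \<le> m" and A: "A \<subseteq> B"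
  shows "\<bar>generator f A\<bar> \<le> 2 * c B * m"
proof -
  have cB: "0 \<le> c B"
    unfolding sum_positive_rates[symmetric] by (intro sum_nonneg jump_rate_nonneg) auto
  have "\<bar>generator f A\<bar> \<le> (\<Sum>C\<in>Pow B. \<bar>jump_rate C * f (A \<union> C)\<bar>)"
    unfolding generator_def by (rule sum_abs)
  also have "\<dots> \<le> (\<Sum>C\<in>Pow B. \<bar>jump_rate C\<bar> * m)"
    using f A by (intro sum_mono) (auto simp: abs_mult intro!: mult_left_mono)
  also have "\<dots> = (\<Sum>C\<in>Pow B. \<bar>jump_rate C\<bar>) * m"
    by (simp add: sum_distrib_right)
  also have "(\<Sum>C\<in>Pow B. \<bar>jump_rate C\<bar>) =
      \<bar>jump_rate {}\<bar> + (\<Sum>C\<in>Pow B - {{}}. \<bar>jump_rate C\<bar>)"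
    using finite_window by (intro sum.remove) auto
  also have "(\<Sum>C\<in>Pow B - {{}}. \<bar>jump_rate C\<bar>) = (\<Sum>C\<in>Pow B - {{}}. jump_rate C)"
    by (rule sum.cong) (auto intro!: abs_of_nonneg jump_rate_nonneg)
  finally show ?thesis
    using cB by (simp add: jump_rate_empty sum_positive_rates)
qed

text \<open>Every jump can only decrease \<open>f\<close>, and a jump that covers \<open>x\<close> brings it to \<open>0\<close>.  Such
  jumps have total rate \<open>c {x}\<close>.\<close>

lemma mean_generator_le:
  assumes "0 \<le> u" "x \<in> B"
    and f_nonneg: "\<And>A. 0 \<le> f A"
    and decreasing: "\<And>A C. A \<subseteq> C \<Longrightarrow> f C \<le> f A"
    and killed: "\<And>A. x \<in> A \<Longrightarrow> f A = 0"
  shows "mean (generator f) u \<le> - c {x} * mean f u"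
proof -
  have "generator f A \<le> - c {x} * f A" for A
  proof -
    have "generator f A \<le> (\<Sum>C\<in>Pow B. f A * (jump_rate C * of_bool (C \<inter> {x} = {})))"
      unfolding generator_def
    proof (rule sum_mono)
      fix C assume C: "C \<in> Pow B"
      show "jump_rate C * f (A \<union> C) \<le> f A * (jump_rate C * of_bool (C \<inter> {x} = {}))"
      proof (cases "C = {}")
        case False
        then have "jump_rate C * f (A \<union> C) \<le> jump_rate C * f A"
          using C decreasing[of A "A \<union> C"] jump_rate_nonneg[of C]
          by (intro mult_left_mono) auto
        then show ?thesis
          using killed[of "A \<union> C"] by (auto simp: mult.commute)
      qed (simp add: mult.commute)
    qed
    also have "\<dots> = f A * (- c {x})"
      unfolding sum_distrib_left[symmetric] sum_avoiding
      using sum_jump_rate[of "{x}"] assms(2) by simp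
    finally show ?thesis by (simp add: mult.commute)
  qed
  then have "mean (generator f) u \<le> mean (\<lambda>A. - c {x} * f A) u"
    using assms(1) by (intro mean_mono)
  then show ?thesis
    unfolding mean_scale .
qed

end

section \<open>Uniform convergence of derivatives by interpolation\<close>

text \<open>A Landau-Kolmogorov inequality: the difference quotient of \<open>f\<close> on scale \<open>s\<close> is at most
  \<open>2 * \<epsilon> / s\<close>, and it differs from \<open>f'\<close> by at most \<open>s * P\<close>.  Since \<open>2 * s \<le> b\<close>, there is
  room for the step \<open>s\<close> on one side of \<open>x\<close>, also at the endpoints.\<close>

lemma derivative_interpolation:
  fixes f f' f'' :: "real \<Rightarrow> real"
  assumes f': "\<And>x. x \<in> {0..b} \<Longrightarrow> (f has_real_derivative f' x) (at x within {0..b})"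
    and f'': "\<And>x. x \<in> {0..b} \<Longrightarrow> (f' has_real_derivative f'' x) (at x within {0..b})"
    and small: "\<And>x. x \<in> {0..b} \<Longrightarrow> \<bar>f x\<bar> \<le> \<epsilon>"
    and bounded: "\<And>x. x \<in> {0..b} \<Longrightarrow> \<bar>f'' x\<bar> \<le> P"
    and s: "0 < s" "2 * s \<le> b" and x: "x \<in> {0..b}"
  shows "\<bar>f' x\<bar> \<le> 2 * \<epsilon> / s + s * P"
proof -
  define y where "y = (if x + s \<le> b then x + s else x - s)"
  have y: "y \<in> {0..b}" "\<bar>y - x\<bar> = s"
    using s x by (auto simp: y_def)
  define S where "S = closed_segment x y"
  have S: "convex S" "S \<subseteq> {0..b}" "x \<in> S" "y \<in> S"
    using x y(1) closed_segment_subset[of x "{0..b}" y] by (auto simp: S_def)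
  have dist: "\<bar>z - x\<bar> \<le> s" if "z \<in> S" for z
    using that y(2) by (auto simp: S_def closed_segment_eq_real_ivl split: if_splits)
  have P: "0 \<le> P"
    using bounded[OF x] by linarith
  have slope: "\<bar>f' z - f' x\<bar> \<le> P * s" if "z \<in> S" for z
  proof -
    have "norm (f' z - f' x) \<le> P * norm (z - x)"
    proof (rule field_differentiable_bound[OF convex_real_interval(5)[of 0 b]])
      show "(f' has_real_derivative f'' t) (at t within {0..b})" if "t \<in> {0..b}" for t
        using f'' that .
    qed (use bounded that S x in auto)
    also have "\<dots> \<le> P * s"
      using dist[OF that] P by (intro mult_left_mono) auto
    finally show ?thesis by simp
  qed
  have "norm ((f y - y * f' x) - (f x - x * f' x)) \<le> (P * s) * norm (y - x)"
  proof (rule field_differentiable_bound[OF S(1)])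
    fix z assume z: "z \<in> S"
    show "((\<lambda>t. f t - t * f' x) has_real_derivative f' z - f' x) (at z within S)"
      using has_field_derivative_subset[OF f' S(2), of z] z S(2)
      by (auto intro!: derivative_eq_intros)
    show "norm (f' z - f' x) \<le> P * s"
      using slope[OF z] by simp
  qed (use S in auto)
  then have "\<bar>(y - x) * f' x - (f y - f x)\<bar> \<le> P * s * s"
    using y(2) by (simp add: algebra_simps abs_minus_commute)
  then have "\<bar>(y - x) * f' x\<bar> \<le> P * s * s + 2 * \<epsilon>"
    using small[OF x] small[OF y(1)] by linarith
  then have "s * \<bar>f' x\<bar> \<le> P * s * s + 2 * \<epsilon>"
    using y(2) by (simp add: abs_mult)
  then show ?thesis
    using s(1) by (simp add: field_simps)
qed

lemma summable_interpolation_bound: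
  fixes c \<gamma> :: real
  assumes "0 < c" "0 < \<gamma>"
  shows "summable (\<lambda>n. 4 * exp (- c * real n powr \<gamma>) * real (Suc n) ^ k)"
proof (rule summable_comparison_test_bigo)
  show "summable (\<lambda>n. norm (1 / real n ^ 2))"
    using inverse_power_summable[of 2, where 'a = real] by (simp add: field_simps)
  have "(\<lambda>x::real. 4 * exp (- c * x powr \<gamma>) * (1 + x) powr real k) \<in> O(\<lambda>x. 1 / x ^ 2)"
    using assms by real_asymp
  from landau_o.big.compose[OF this filterlim_real_sequentially]
  show "(\<lambda>n. 4 * exp (- c * real n powr \<gamma>) * real (Suc n) ^ k) \<in> O(\<lambda>n. 1 / real n ^ 2)"
    by (simp add: powr_realpow)
qed

text \<open>On the scale \<open>s = n ^ (- (k + 2))\<close> a second derivative of size \<open>n ^ k\<close> costs only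
  \<open>n ^ (- 2)\<close>, while dividing a stretched-exponentially small quantity by \<open>s\<close> leaves it
  summable.\<close>

lemma C1_limit_of_fast_convergence:
  fixes g g' g'' :: "nat \<Rightarrow> real \<Rightarrow> real" and h :: "real \<Rightarrow> real"
  assumes b: "0 < b" and \<gamma>: "0 < c" "0 < \<gamma>"
    and g': "\<And>n x. x \<in> {0..b} \<Longrightarrow> (g n has_real_derivative g' n x) (at x within {0..b})"
    and g'': "\<And>n x. x \<in> {0..b} \<Longrightarrow> (g' n has_real_derivative g'' n x) (at x within {0..b})"
    and bounded: "\<And>n x. x \<in> {0..b} \<Longrightarrow> \<bar>g'' n x\<bar> \<le> C * real (2 * n + 1) ^ k"
    and fast: "\<And>n x. N \<le> n \<Longrightarrow> x \<in> {0..b} \<Longrightarrow> \<bar>g n x - h x\<bar> \<le> exp (- c * real n powr \<gamma>)"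
  shows "uniform_limit {0..b} g' (\<lambda>x. lim (\<lambda>n. g' n x)) sequentially"
    and "\<And>x. x \<in> {0..b} \<Longrightarrow>
      (h has_real_derivative lim (\<lambda>n. g' n x)) (at x within {0..b})"
proof -
  define \<epsilon> where "\<epsilon> n = exp (- c * real n powr \<gamma>)" for n
  define s where "s n = 1 / real (Suc n) ^ (k + 2)" for n
  define P where "P n = 2 * C * 3 ^ k * real (Suc n) ^ k" for n
  define m where "m n = 2 * (2 * \<epsilon> n) / s n + s n * P n" for n
  have s_pos: "0 < s n" for n
    by (simp add: s_def)
  have C: "0 \<le> C"
    using bounded[of 0 0] b by simp
  have "filterlim s (nhds 0) sequentially"
    unfolding s_def by real_asymp
  then have "eventually (\<lambda>n. s n < b / 2) sequentially"
    using b by (intro order_tendstoD) auto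
  then have s_small: "eventually (\<lambda>n. 2 * s n \<le> b) sequentially"
    by eventually_elim auto
  have "summable m"
  proof -
    have "(\<lambda>n. 2 * (2 * \<epsilon> n) / s n) = (\<lambda>n. 4 * \<epsilon> n * real (Suc n) ^ (k + 2))"
      by (simp add: s_def fun_eq_iff)
    moreover have "summable (\<lambda>n. 4 * \<epsilon> n * real (Suc n) ^ (k + 2))"
      unfolding \<epsilon>_def by (rule summable_interpolation_bound[OF \<gamma>])
    moreover have "(\<lambda>n. s n * P n) = (\<lambda>n. 2 * C * 3 ^ k * inverse (real (Suc n) ^ 2))"
      by (simp add: s_def P_def fun_eq_iff field_simps power_add power2_eq_square del: of_nat_Suc)
    moreover have "summable (\<lambda>n. inverse (real (Suc n) ^ 2))"
      using inverse_power_summable[of 2, where 'a = real]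
      by (subst summable_Suc_iff) simp
    ultimately show ?thesis
      unfolding m_def by (intro summable_add) (auto intro: summable_mult)
  qed
  (* The limit h is known to be close to each g n but not yet to be smooth, so the
     interpolation is applied to the increments of g, whose sum telescopes. *)
  define f where "f n x = g (Suc n) x - g n x" for n x
  define f' where "f' n x = g' (Suc n) x - g' n x" for n x
  define f'' where "f'' n x = g'' (Suc n) x - g'' n x" for n x
  have df: "(f n has_real_derivative f' n x) (at x within {0..b})" if "x \<in> {0..b}" for n x
    unfolding f_def f'_def using that by (intro DERIV_diff g')
  have df': "(f' n has_real_derivative f'' n x) (at x within {0..b})" if "x \<in> {0..b}" for n x
    unfolding f'_def f''_def using that by (intro DERIV_diff g'')
  have f_small: "\<bar>f n x\<bar> \<le> 2 * \<epsilon> n" if "N \<le> n" "x \<in> {0..b}" for n x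
  proof -
    have "\<epsilon> (Suc n) \<le> \<epsilon> n"
      using \<gamma> by (simp add: \<epsilon>_def powr_mono2)
    then show ?thesis
      using fast[OF that] fast[of "Suc n" x] that unfolding f_def \<epsilon>_def
      by (smt (verit) le_SucI)
  qed
  have f''_bound: "\<bar>f'' n x\<bar> \<le> P n" if "x \<in> {0..b}" for n x
  proof -
    have "C * real (2 * i + 1) ^ k \<le> C * (3 * real (Suc n)) ^ k" if "i \<le> Suc n" for i
      using C that by (intro mult_left_mono power_mono) auto
    from this[of n] this[of "Suc n"] show ?thesis
      using bounded[OF that, of n] bounded[OF that, of "Suc n"]
      by (simp add: f''_def P_def power_mult_distrib del: of_nat_Suc)
  qed
  have "eventually (\<lambda>n. \<forall>x\<in>{0..b}. norm (f' n x) \<le> m n) sequentially"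
    using s_small eventually_ge_at_top[of N]
  proof eventually_elim
    case (elim n)
    show ?case
    proof
      fix x assume "x \<in> {0..b}"
      then show "norm (f' n x) \<le> m n"
        unfolding m_def real_norm_def
        by (intro derivative_interpolation[OF df df' _ _ s_pos elim(1)])
          (auto intro: f_small f''_bound elim(2))
    qed
  qed
  from Weierstrass_m_test_ev[OF this \<open>summable m\<close>]
  have sum_limit: "uniform_limit {0..b} (\<lambda>n x. \<Sum>i<n. f' i x) (\<lambda>x. \<Sum>i. f' i x) sequentially" .
  have telescope: "(\<Sum>i<n. f i x) = g n x - g 0 x" "(\<Sum>i<n. f' i x) = g' n x - g' 0 x" for n x
    by (induction n) (auto simp: f_def f'_def)
  have "uniform_limit {0..b} (\<lambda>n x. (\<Sum>i<n. f' i x) + g' 0 x) (\<lambda>x. (\<Sum>i. f' i x) + g' 0 x)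
      sequentially"
    by (intro uniform_limit_intros sum_limit)
  then have unif: "uniform_limit {0..b} g' (\<lambda>x. (\<Sum>i. f' i x) + g' 0 x) sequentially"
    unfolding telescope by simp
  have limit: "lim (\<lambda>n. g' n x) = (\<Sum>i. f' i x) + g' 0 x" if "x \<in> {0..b}" for x
    using tendsto_uniform_limitI[OF unif that] by (rule limI)
  show "uniform_limit {0..b} g' (\<lambda>x. lim (\<lambda>n. g' n x)) sequentially"
    using unif by (rule uniform_limit_cong'[THEN iffD1, rotated 2]) (auto simp: limit)
  have h_lim: "(\<lambda>n. g n x) \<longlonglongrightarrow> h x" if "x \<in> {0..b}" for x
  proof -
    have "(\<lambda>n. exp (- c * real n powr \<gamma>)) \<longlonglongrightarrow> 0"
      using \<gamma> by real_asymp
    then have "(\<lambda>n. g n x - h x) \<longlonglongrightarrow> 0"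
      by (rule Lim_null_comparison[rotated])
        (use fast that in \<open>auto intro!: eventually_sequentiallyI[of N]\<close>)
    then show ?thesis
      by (simp add: LIM_zero_iff)
  qed
  have f_sums: "(\<lambda>n. f n x) sums (h x - g 0 x)" if "x \<in> {0..b}" for x
    unfolding sums_def telescope using h_lim[OF that] by (intro tendsto_intros)
  obtain G where G: "\<And>x. x \<in> {0..b} \<Longrightarrow> (\<lambda>n. f n x) sums G x"
    "\<And>x. x \<in> {0..b} \<Longrightarrow> (G has_real_derivative (\<Sum>i. f' i x)) (at x within {0..b})"
    using has_field_derivative_series[OF convex_real_interval(5) df sum_limit, of 0]
      f_sums[of 0] b by (auto simp: sums_iff)
  show "(h has_real_derivative lim (\<lambda>n. g' n x)) (at x within {0..b})" if x: "x \<in> {0..b}" for x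
  proof -
    have "((\<lambda>x. G x + g 0 x) has_real_derivative lim (\<lambda>n. g' n x)) (at x within {0..b})"
      unfolding limit[OF x] using x by (intro DERIV_add G(2) g')
    then show ?thesis
    proof (rule has_field_derivative_transform_within[OF _ zero_less_one x])
      fix y assume "y \<in> {0..b}"
      then show "G y + g 0 y = h y"
        using sums_unique2[OF G(1) f_sums] by simp
    qed
  qed
qed

section \<open>Connections in the lattice\<close>

lemma connected_in_mono: "V \<subseteq> W \<Longrightarrow> connected_in V x y \<Longrightarrow> connected_in W x y"
proof -
  assume "V \<subseteq> W" "connected_in V x y"
  moreover have "{(a, b). a \<in> V \<and> b \<in> V \<and> nn a b}\<^sup>* \<subseteq> {(a, b). a \<in> W \<and> b \<in> W \<and> nn a b}\<^sup>*"
    using \<open>V \<subseteq> W\<close> by (intro rtrancl_mono) auto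
  ultimately show ?thesis
    unfolding connected_in_def by blast
qed

lemma connected_in_refl: "x \<in> V \<Longrightarrow> connected_in V x x"
  by (simp add: connected_in_def)

lemma connected_in_step:
  "connected_in V x y \<Longrightarrow> y \<in> V \<Longrightarrow> z \<in> V \<Longrightarrow> nn y z \<Longrightarrow> connected_in V x z"
  unfolding connected_in_def by (auto intro: rtrancl_into_rtrancl)

lemma connected_in_induct [consumes 1, case_names refl step]:
  assumes "connected_in V x y"
    and "x \<in> V \<Longrightarrow> Q x"
    and "\<And>y z. connected_in V x y \<Longrightarrow> y \<in> V \<Longrightarrow> z \<in> V \<Longrightarrow> nn y z \<Longrightarrow> Q y \<Longrightarrow> Q z"
  shows "Q y"
proof -
  have x: "x \<in> V" and r: "(x, y) \<in> {(a, b). a \<in> V \<and> b \<in> V \<and> nn a b}\<^sup>*"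
    using assms(1) by (auto simp: connected_in_def)
  from r show ?thesis
  proof (induction rule: rtrancl_induct)
    case base
    then show ?case using assms(2) x by blast
  next
    case (step y z)
    then show ?case using assms(3)[of y z] x by (auto simp: connected_in_def)
  qed
qed

text \<open>A path has finitely many sites, so connection events are countable unions of events
  that a given finite set is vacant.\<close>

lemma connected_in_iff_finite_subset:
  "connected_in V x y \<longleftrightarrow> (\<exists>K. finite K \<and> K \<subseteq> V \<and> connected_in K x y)"
proof
  assume "connected_in V x y"
  then show "\<exists>K. finite K \<and> K \<subseteq> V \<and> connected_in K x y"
  proof (induction rule: connected_in_induct)
    case refl
    then show ?case
      by (intro exI[of _ "{x}"]) (simp add: connected_in_refl)
  next
    case (step y z)
    then obtain K where K: "finite K" "K \<subseteq> V" "connected_in K x y"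
      by blast
    have "connected_in (insert y (insert z K)) x y"
      using K(3) by (rule connected_in_mono[rotated]) auto
    then have "connected_in (insert y (insert z K)) x z"
      using step.hyps by (auto intro: connected_in_step)
    with K step.hyps show ?case
      by (intro exI[of _ "insert y (insert z K)"]) auto
  qed
qed (blast intro: connected_in_mono)

lemma connected_in_crosses_boundary:
  assumes "connected_in V x y" "x \<in> B" "y \<notin> B"
  shows "\<exists>z\<in>inner_boundary B. connected_in (B \<inter> V) x z"
proof -
  have "(y \<in> B \<and> connected_in (B \<inter> V) x y) \<or>
      (\<exists>z\<in>inner_boundary B. connected_in (B \<inter> V) x z)"
    using assms(1)
  proof (induction rule: connected_in_induct)
    case refl
    with assms(2) show ?case by (simp add: connected_in_refl)
  next
    case (step y z)
    show ?case
    proof (cases "\<exists>z\<in>inner_boundary B. connected_in (B \<inter> V) x z")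
      case False
      with step.IH have y: "y \<in> B" "connected_in (B \<inter> V) x y"
        by auto
      have "z \<in> B"
      proof (rule ccontr)
        assume "z \<notin> B"
        with y(1) step.hyps have "y \<in> inner_boundary B"
          by (auto simp: inner_boundary_def)
        with y(2) False show False by blast
      qed
      with y step.hyps show ?thesis
        by (auto intro: connected_in_step)
    qed simp
  qed
  with assms(3) show ?thesis by blast
qed

lemma sup_ball_subset:
  "sup_ball (real n) \<subseteq> vec_lambda ` (UNIV \<rightarrow>\<^sub>E {- int n..int n} :: ('d::finite \<Rightarrow> int) set)"
proof
  fix x :: "int ^ 'd"
  assume "x \<in> sup_ball (real n)"
  then have "sup_norm x \<le> int n"
    unfolding sup_ball_def mem_Collect_eq by linarith
  moreover have "\<bar>x $ i\<bar> \<le> sup_norm x" for i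
    unfolding sup_norm_def by (rule Max_ge) auto
  ultimately have "\<bar>x $ i\<bar> \<le> int n" for i
    by (meson order_trans)
  then have "vec_nth x \<in> UNIV \<rightarrow>\<^sub>E {- int n..int n}"
    by (auto simp: abs_le_iff minus_le_iff)
  then show "x \<in> vec_lambda ` (UNIV \<rightarrow>\<^sub>E {- int n..int n})"
    by (metis image_eqI vec_nth_inverse)
qed

lemma finite_sup_ball: "finite (sup_ball (real n) :: (int ^ 'd) set)"
  by (rule finite_subset[OF sup_ball_subset]) (auto intro!: finite_imageI finite_PiE)

lemma card_sup_ball_le: "card (sup_ball (real n) :: (int ^ 'd) set) \<le> (2 * n + 1) ^ CARD('d)"
proof -
  have fin: "finite (UNIV \<rightarrow>\<^sub>E {- int n..int n} :: ('d \<Rightarrow> int) set)"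
    by (auto intro!: finite_PiE)
  have "card (sup_ball (real n) :: (int ^ 'd) set) \<le>
      card (UNIV \<rightarrow>\<^sub>E {- int n..int n} :: ('d \<Rightarrow> int) set)"
    using card_mono[OF finite_imageI[OF fin] sup_ball_subset] card_image_le[OF fin]
    by (rule order_trans)
  also have "\<dots> = (2 * n + 1) ^ CARD('d)"
    by (simp add: card_PiE nat_add_distrib nat_mult_distrib)
  finally show ?thesis .
qed

lemma zero_in_sup_ball: "0 \<in> sup_ball (real n)"
  by (simp add: sup_ball_def sup_norm_def)

lemma infinite_cluster_UNIV: "infinite (cluster UNIV (0 :: int ^ 'd))"
proof -
  define e :: "nat \<Rightarrow> int ^ 'd" where "e k = axis undefined (int k)" for k
  have "connected_in UNIV 0 (e k)" for k
  proof (induction k)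
    case 0
    then show ?case
      by (simp add: e_def axis_def zero_vec_def connected_in_refl flip: zero_vec_def)
  next
    case (Suc k)
    have "(\<Sum>i\<in>UNIV. \<bar>(e k - e (Suc k)) $ i\<bar>) =
        (\<Sum>i\<in>(UNIV :: 'd set). if i = undefined then 1 else 0)"
      by (rule sum.cong) (auto simp: e_def axis_def)
    then have "nn (e k) (e (Suc k))"
      by (simp add: nn_def l1_norm_def)
    with Suc show ?case
      by (auto intro: connected_in_step)
  qed
  then have "range e \<subseteq> cluster UNIV 0"
    by (auto simp: cluster_def)
  moreover have "infinite (range e)"
    by (intro range_inj_infinite injI) (auto simp: e_def axis_eq_axis)
  ultimately show ?thesis
    by (rule infinite_super)
qed

lemma infinite_iff_leaves_finite_sets:
  "infinite A \<longleftrightarrow> (\<forall>F\<in>{F. finite F}. \<exists>y\<in>- F. y \<in> A)"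
proof
  show "\<forall>F\<in>{F. finite F}. \<exists>y\<in>- F. y \<in> A" if "infinite A"
    using that by (metis ComplI finite_subset mem_Collect_eq subsetI)
  show "infinite A" if "\<forall>F\<in>{F. finite F}. \<exists>y\<in>- F. y \<in> A"
    using that by auto
qed

section \<open>Bounds on the capacity\<close>

lemma prob_space_srw_steps: "prob_space srw_steps"
  unfolding srw_steps_def by (intro prob_space_PiM prob_space_measure_pmf)

lemma cap_nonneg: "0 \<le> cap K"
  unfolding cap_def escape_prob_def by (intro sum_nonneg) simp

lemma cap_le_card: "cap K \<le> card K"
proof -
  have "(\<Sum>x\<in>K. escape_prob K x) \<le> of_nat (card K) * 1"
    unfolding escape_prob_def
    by (intro sum_bounded_above prob_space.prob_le_1[OF prob_space_srw_steps])
  then show ?thesis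
    by (simp add: cap_def)
qed

lemma cap_singleton: "cap {x :: int ^ 'd} = cap {0 :: int ^ 'd}"
  by (simp add: cap_def escape_prob_def srw_def)

lemma cap_sup_ball_le: "cap (sup_ball (real n) :: (int ^ 'd) set) \<le> real (2 * n + 1) ^ CARD('d)"
proof -
  have "cap (sup_ball (real n) :: (int ^ 'd) set) \<le> real (card (sup_ball (real n) :: (int ^ 'd) set))"
    by (rule cap_le_card)
  also have "\<dots> \<le> real ((2 * n + 1) ^ CARD('d))"
    using card_sup_ball_le by (rule of_nat_mono)
  finally show ?thesis
    by (simp only: of_nat_power)
qed

section \<open>Crossing probabilities of the vacant set\<close>

text \<open>The set \<open>A\<close> is the occupied one.  The path has to stay in the box, which makes this a
  function of the trace of \<open>A\<close> on the box.\<close>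

definition crosses :: "nat \<Rightarrow> (int ^ 'd) set \<Rightarrow> bool" where
  "crosses n A \<longleftrightarrow>
    (\<exists>y\<in>inner_boundary (sup_ball (real n)). connected_in (sup_ball (real n) - A) 0 y)"

lemma crosses_antimono: "A \<subseteq> C \<Longrightarrow> crosses n C \<Longrightarrow> crosses n A"
  unfolding crosses_def using connected_in_mono[OF Diff_mono[OF order_refl]] by blast

lemma not_crosses_if_covered: "0 \<in> A \<Longrightarrow> \<not> crosses n A"
  by (simp add: crosses_def connected_in_def)

lemma infinite_cluster_crosses:
  assumes "infinite (cluster (- A) 0)"
  shows "crosses n A"
proof -
  obtain y where "y \<in> cluster (- A) 0" "y \<notin> sup_ball (real n)"
    using assms finite_sup_ball by (meson finite_subset subsetI)
  then show ?thesis
    using connected_in_crosses_boundary[of "- A" 0 y "sup_ball (real n)"] zero_in_sup_ball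
    by (auto simp: cluster_def crosses_def Diff_eq)
qed

context random_interlacements
begin

lemma measurable_vacant:
  assumes "0 \<le> u" "finite K"
  shows "{\<omega> \<in> space M. K \<subseteq> vacant I u \<omega>} \<in> events"
proof -
  have "{\<omega> \<in> space M. \<forall>x\<in>K. \<not> x \<in> I u \<omega>} \<in> events"
    using assms by (intro sets.sets_Collect_finite_All sets.sets_Collect_neg measurable_site)
  moreover have "{\<omega> \<in> space M. \<forall>x\<in>K. \<not> x \<in> I u \<omega>} = {\<omega> \<in> space M. K \<subseteq> vacant I u \<omega>}"
    by (auto simp: vacant_def)
  ultimately show ?thesis by simp
qed

lemma measurable_some_vacant:
  assumes "0 \<le> u" "\<And>K. K \<in> \<K> \<Longrightarrow> finite K"
  shows "{\<omega> \<in> space M. \<exists>K\<in>\<K>. K \<subseteq> vacant I u \<omega>} \<in> events"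
proof (rule sets.sets_Collect_countable_Ex')
  show "countable \<K>"
    by (rule countable_subset[OF _ countable_Collect_finite]) (use assms in auto)
qed (use assms measurable_vacant in auto)

lemma measurable_connected:
  assumes "0 \<le> u"
  shows "{\<omega> \<in> space M. connected_in (vacant I u \<omega>) x y} \<in> events"
proof -
  have "{\<omega> \<in> space M. connected_in (vacant I u \<omega>) x y} =
      {\<omega> \<in> space M. \<exists>K\<in>{K. finite K \<and> connected_in K x y}. K \<subseteq> vacant I u \<omega>}"
    unfolding connected_in_iff_finite_subset[of "vacant I u _"] by auto
  then show ?thesis
    using measurable_some_vacant[OF assms, of "{K. finite K \<and> connected_in K x y}"] by simp
qed

lemma measurable_infinite_cluster:
  assumes "0 \<le> u"
  shows "{\<omega> \<in> space M. infinite (cluster (vacant I u \<omega>) 0)} \<in> events"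
proof -
  have "{\<omega> \<in> space M. \<exists>y\<in>- F. y \<in> cluster (vacant I u \<omega>) 0} \<in> events" for F
    unfolding cluster_def mem_Collect_eq
    by (intro sets.sets_Collect_countable_Bex measurable_connected assms)
  then show ?thesis
    unfolding infinite_iff_leaves_finite_sets
    by (intro sets.sets_Collect_countable_All' countable_Collect_finite)
qed

lemma measurable_crosses:
  assumes "0 \<le> u"
  shows "{\<omega> \<in> space M. crosses n (I u \<omega>)} \<in> events"
proof -
  let ?B = "sup_ball (real n) :: (int ^ 'd) set"
  let ?\<K> = "{K. K \<subseteq> ?B \<and> (\<exists>y\<in>inner_boundary ?B. connected_in K 0 y)}"
  have "crosses n A \<longleftrightarrow> (\<exists>K\<in>?\<K>. K \<subseteq> - A)" for A
  proof
    assume "crosses n A"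
    then show "\<exists>K\<in>?\<K>. K \<subseteq> - A"
      by (intro bexI[of _ "?B - A"]) (auto simp: crosses_def)
  next
    assume "\<exists>K\<in>?\<K>. K \<subseteq> - A"
    then obtain K y where K: "K \<subseteq> ?B - A" "y \<in> inner_boundary ?B" "connected_in K 0 y"
      by blast
    then show "crosses n A"
      unfolding crosses_def using connected_in_mono[OF K(1,3)] by blast
  qed
  then show ?thesis
    using measurable_some_vacant[OF assms, of ?\<K>] finite_sup_ball[of n, where 'd = 'd]
    by (auto simp: vacant_def intro: finite_subset)
qed

lemma theta0_eq:
  assumes "0 \<le> u"
  shows "theta0 M I u = 1 - prob {\<omega> \<in> space M. infinite (cluster (vacant I u \<omega>) 0)}"
  unfolding theta0_def by (rule prob_neg[OF measurable_infinite_cluster[OF assms]])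

lemma prob_finite_union_of_traces:
  assumes u: "0 \<le> u" and B: "finite B" and \<A>: "\<A> \<subseteq> Pow B"
  shows "prob {\<omega> \<in> space M. I u \<omega> \<inter> B \<in> \<A>} =
    (\<Sum>A\<in>\<A>. prob {\<omega> \<in> space M. I u \<omega> \<inter> B = A})"
proof -
  have meas: "{\<omega> \<in> space M. I u \<omega> \<inter> B = A} \<in> events" if "A \<subseteq> B" for A
  proof -
    have "{\<omega> \<in> space M. x \<in> I u \<omega> \<longleftrightarrow> x \<in> A} \<in> events" for x
      using measurable_site[OF u] sets.sets_Collect_neg[OF measurable_site[OF u]]
      by (cases "x \<in> A") auto
    then have "{\<omega> \<in> space M. \<forall>x\<in>B. x \<in> I u \<omega> \<longleftrightarrow> x \<in> A} \<in> events"
      using B by (intro sets.sets_Collect_finite_All)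
    moreover have "{\<omega> \<in> space M. \<forall>x\<in>B. x \<in> I u \<omega> \<longleftrightarrow> x \<in> A} =
        {\<omega> \<in> space M. I u \<omega> \<inter> B = A}"
      using that by auto
    ultimately show ?thesis by simp
  qed
  have "prob (\<Union>A\<in>\<A>. {\<omega> \<in> space M. I u \<omega> \<inter> B = A}) =
      (\<Sum>A\<in>\<A>. prob {\<omega> \<in> space M. I u \<omega> \<inter> B = A})"
    using \<A> B meas
    by (intro finite_measure_finite_Union) (auto simp: disjoint_family_on_def intro: finite_subset)
  moreover have "(\<Union>A\<in>\<A>. {\<omega> \<in> space M. I u \<omega> \<inter> B = A}) = {\<omega> \<in> space M. I u \<omega> \<inter> B \<in> \<A>}"
    by auto
  ultimately show ?thesis by simp
qed

text \<open>A subset \<open>K\<close> of the window is vacant exactly when the trace avoids it, so the law of the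
  vacant set is the law of the traces.\<close>

lemma exponential_vacancy_trace:
  assumes "finite B"
  shows "exponential_vacancy B (\<lambda>A u. prob {\<omega> \<in> space M. I u \<omega> \<inter> B = A}) cap"
proof
  fix K and u :: real
  assume K: "K \<subseteq> B" and u: "0 \<le> u"
  have "(\<Sum>A\<in>Pow (B - K). prob {\<omega> \<in> space M. I u \<omega> \<inter> B = A}) =
      prob {\<omega> \<in> space M. I u \<omega> \<inter> B \<in> Pow (B - K)}"
    by (rule prob_finite_union_of_traces[symmetric, OF u assms]) auto
  also have "{\<omega> \<in> space M. I u \<omega> \<inter> B \<in> Pow (B - K)} = {\<omega> \<in> space M. K \<subseteq> vacant I u \<omega>}"
    using K by (auto simp: vacant_def)
  finally show "(\<Sum>A\<in>Pow (B - K). prob {\<omega> \<in> space M. I u \<omega> \<inter> B = A}) = exp (- u * cap K)"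
    using vacant_law[OF u finite_subset[OF K assms]] by simp
qed (use assms in \<open>auto simp: cap_def\<close>)

definition crossing_prob :: "nat \<Rightarrow> real \<Rightarrow> real" where
  "crossing_prob n u = prob {\<omega> \<in> space M. crosses n (I u \<omega>)}"

text \<open>The second derivative comes from two applications of the generator, each of which
  costs a factor of twice the capacity of the box: it is only polynomially large.  The
  derivative itself is at most minus the contribution of the jumps that cover the origin.\<close>

lemma crossing_prob_derivatives:
  "\<exists>F' F''. \<forall>u\<ge>0.
    (crossing_prob n has_real_derivative F' u) (at u within {0..}) \<and>
    (F' has_real_derivative F'' u) (at u within {0..}) \<and>
    \<bar>F'' u\<bar> \<le> 4 * real (2 * n + 1) ^ (2 * CARD('d)) \<and>
    F' u \<le> - cap {0 :: int ^ 'd} * crossing_prob n u"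
proof -
  let ?B = "sup_ball (real n) :: (int ^ 'd) set"
  interpret exponential_vacancy ?B "\<lambda>A u. prob {\<omega> \<in> space M. I u \<omega> \<inter> ?B = A}" cap
    by (rule exponential_vacancy_trace[OF finite_sup_ball])
  let ?f = "\<lambda>A. of_bool (crosses n A) :: real"
  have mean_f: "mean ?f u = crossing_prob n u" if u: "0 \<le> u" for u
  proof -
    have "mean ?f u = (\<Sum>A\<in>{A \<in> Pow ?B. crosses n A}. prob {\<omega> \<in> space M. I u \<omega> \<inter> ?B = A})"
      unfolding mean_def
      by (rule sum.mono_neutral_cong_right) (use finite_sup_ball[of n, where 'd = 'd] in auto)
    also have "\<dots> = prob {\<omega> \<in> space M. I u \<omega> \<inter> ?B \<in> {A \<in> Pow ?B. crosses n A}}"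
      by (rule prob_finite_union_of_traces[symmetric, OF u finite_sup_ball]) auto
    also have "{\<omega> \<in> space M. I u \<omega> \<inter> ?B \<in> {A \<in> Pow ?B. crosses n A}} =
        {\<omega> \<in> space M. crosses n (I u \<omega>)}"
      by (auto simp: crosses_def Diff_Int)
    finally show ?thesis
      by (simp add: crossing_prob_def)
  qed
  let ?F' = "mean (generator ?f)" and ?F'' = "mean (generator (generator ?f))"
  have "(crossing_prob n has_real_derivative ?F' u) (at u within {0..}) \<and>
      (?F' has_real_derivative ?F'' u) (at u within {0..}) \<and>
      \<bar>?F'' u\<bar> \<le> 4 * real (2 * n + 1) ^ (2 * CARD('d)) \<and>
      ?F' u \<le> - cap {0 :: int ^ 'd} * crossing_prob n u" if u: "0 \<le> u" for u
  proof (intro conjI)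
    show "(crossing_prob n has_real_derivative ?F' u) (at u within {0..})"
      by (rule has_field_derivative_transform_within[OF mean_has_derivative[OF u, of ?f] zero_less_one])
        (use u mean_f in auto)
    show "(?F' has_real_derivative ?F'' u) (at u within {0..})"
      by (rule mean_has_derivative[OF u])
    have "\<bar>?F'' u\<bar> \<le> 2 * cap ?B * (2 * cap ?B * 1)"
      by (intro abs_mean_le abs_generator_le u) auto
    also have "\<dots> \<le> 2 * real (2 * n + 1) ^ CARD('d) * (2 * real (2 * n + 1) ^ CARD('d) * 1)"
      using cap_sup_ball_le[of n, where 'd = 'd] cap_nonneg[of ?B] by (intro mult_mono) auto
    also have "\<dots> = 4 * real (2 * n + 1) ^ (2 * CARD('d))"
      unfolding mult_2[of "CARD('d)"] power_add by simp
    finally show "\<bar>?F'' u\<bar> \<le> 4 * real (2 * n + 1) ^ (2 * CARD('d))" .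
    show "?F' u \<le> - cap {0 :: int ^ 'd} * crossing_prob n u"
      unfolding mean_f[OF u, symmetric]
      by (rule mean_generator_le[OF u zero_in_sup_ball])
        (auto simp: not_crosses_if_covered intro: crosses_antimono)
  qed
  then show ?thesis by blast
qed

section \<open>Approximation of the percolation function\<close>

lemma crossing_prob_ge:
  assumes "0 \<le> u"
  shows "1 - theta0 M I u \<le> crossing_prob n u"
proof -
  have "{\<omega> \<in> space M. infinite (cluster (vacant I u \<omega>) 0)} \<subseteq>
      {\<omega> \<in> space M. crosses n (I u \<omega>)}"
    using infinite_cluster_crosses unfolding vacant_def by blast
  from finite_measure_mono[OF this measurable_crosses[OF assms]] show ?thesis
    unfolding theta0_eq[OF assms] crossing_prob_def by simp
qed

text \<open>A crossing inside the box connects the origin to the boundary in the vacant set, and so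
  without percolation from the origin it implies the event estimated by \<open>NLF\<close>.\<close>

lemma crossing_prob_le:
  assumes "0 \<le> u"
  shows "crossing_prob n u \<le> 1 - theta0 M I u + prob {\<omega> \<in> space M.
      (\<exists>y\<in>inner_boundary (sup_ball (real n)). connected_in (vacant I u \<omega>) 0 y) \<and>
      \<not> infinite (cluster (vacant I u \<omega>) 0)}" (is "_ \<le> _ + prob ?E")
proof -
  let ?inf = "{\<omega> \<in> space M. infinite (cluster (vacant I u \<omega>) 0)}"
  have E: "?E \<in> events"
    using assms finite_sup_ball[of n, where 'd = 'd]
    by (intro sets.sets_Collect_conj sets.sets_Collect_neg measurable_infinite_cluster
        sets.sets_Collect_countable_Bex measurable_connected) (auto intro: countableI_type)
  have "{\<omega> \<in> space M. crosses n (I u \<omega>)} \<subseteq> ?inf \<union> ?E"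
    by (auto simp: crosses_def vacant_def intro: connected_in_mono[rotated])
  then have "crossing_prob n u \<le> prob (?inf \<union> ?E)"
    unfolding crossing_prob_def
    using E measurable_infinite_cluster[OF assms] by (intro finite_measure_mono) auto
  also have "\<dots> \<le> prob ?inf + prob ?E"
    using E measurable_infinite_cluster[OF assms] by (intro measure_Un_le)
  finally show ?thesis
    by (simp add: theta0_eq[OF assms])
qed

lemma theta0_zero_if_sites_uncovered:
  assumes u: "0 \<le> u" and null: "\<And>x. u * cap {x :: int ^ 'd} = 0"
  shows "theta0 M I u = 0"
proof -
  have "AE \<omega> in M. {x} \<subseteq> vacant I u \<omega>" for x
    using vacant_law[OF u, of "{x}"] null[of x] measurable_vacant[OF u, of "{x}"]
    by (simp add: prob_Collect_eq_1)
  then have "AE \<omega> in M. \<forall>x. {x} \<subseteq> vacant I u \<omega>"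
    by (subst AE_all_countable) blast
  then have "AE \<omega> in M. infinite (cluster (vacant I u \<omega>) 0)"
  proof eventually_elim
    case (elim \<omega>)
    then have "vacant I u \<omega> = UNIV" by auto
    then show ?case by (simp add: infinite_cluster_UNIV)
  qed
  then show ?thesis
    using measurable_infinite_cluster[OF u] by (simp add: theta0_eq[OF u] prob_Collect_eq_1)
qed

lemma theta0_at_zero: "theta0 M I 0 = 0"
  by (rule theta0_zero_if_sites_uncovered) auto

text \<open>If the capacity of a point were \<open>0\<close>, then by translation invariance almost surely
  no site would be covered and the vacant set would percolate, at every level.\<close>

lemma cap_origin_pos:
  assumes "critical_level M I u_star"
  shows "0 < cap {0 :: int ^ 'd}"
proof (rule ccontr)
  assume "\<not> 0 < cap {0 :: int ^ 'd}"
  then have "cap {x :: int ^ 'd} = 0" for x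
    using cap_nonneg[of "{0 :: int ^ 'd}"] cap_singleton[of x] by simp
  moreover have "0 < u_star"
    using assms by (simp add: critical_level_def)
  ultimately have "theta0 M I (u_star + 1) = 0"
    by (intro theta0_zero_if_sites_uncovered) auto
  then show False
    using assms by (simp add: critical_level_def)
qed

text \<open>This makes the set whose supremum is \<open>u_hat\<close> nonempty.\<close>

lemma NLF_zero_zero: "NLF M I 0 0"
proof -
  have "measure M {\<omega> \<in> space M.
      (\<exists>y\<in>inner_boundary (sup_ball L). connected_in (vacant I 0 \<omega>) 0 y) \<and>
      \<not> infinite (cluster (vacant I 0 \<omega>) 0)} \<le> theta0 M I 0" for L
    unfolding theta0_def
    using sets.sets_Collect_neg[OF measurable_infinite_cluster[OF order_refl]]
    by (intro finite_measure_mono) auto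
  then show ?thesis
    unfolding NLF_def theta0_at_zero
    by (intro exI[of _ 1]) (auto intro: order_trans[OF _ less_imp_le[OF exp_gt_zero]])
qed

lemma u_hat_approximation:
  assumes "critical_level M I u_star" "0 \<le> u" "u < u_hat M I u_star"
  obtains \<beta> where "u < \<beta>" "\<beta> \<le> u_hat M I u_star" "\<beta> < u_star" "NLF M I 0 \<beta>"
proof -
  let ?S = "{u. 0 \<le> u \<and> u < u_star \<and> NLF M I 0 u}"
  have "0 \<in> ?S"
    using assms(1) NLF_zero_zero by (simp add: critical_level_def)
  moreover have bdd: "bdd_above ?S"
    by (rule bdd_aboveI[of _ u_star]) auto
  ultimately obtain \<beta> where "\<beta> \<in> ?S" "u < \<beta>"
    using assms(3) less_cSup_iff[of ?S u] unfolding u_hat_def by blast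
  moreover have "\<beta> \<le> u_hat M I u_star"
    unfolding u_hat_def using bdd \<open>\<beta> \<in> ?S\<close> by (rule cSup_upper[rotated])
  ultimately show thesis
    using that by blast
qed

lemma NLF_crossing_prob:
  assumes "NLF M I 0 \<beta>"
  obtains N c \<gamma> where "0 < c" "0 < \<gamma>" and
    "\<And>n u. N \<le> n \<Longrightarrow> u \<in> {0..\<beta>} \<Longrightarrow>
      \<bar>crossing_prob n u - (1 - theta0 M I u)\<bar> \<le> exp (- c * real n powr \<gamma>)"
proof -
  obtain L c \<gamma> where c: "0 < c" "0 < \<gamma>" and decay: "\<forall>L'\<ge>L. \<forall>u\<in>{0..\<beta>}.
      measure M {\<omega> \<in> space M.
        (\<exists>y\<in>inner_boundary (sup_ball L'). connected_in (vacant I u \<omega>) 0 y) \<and>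
        \<not> infinite (cluster (vacant I u \<omega>) 0)} \<le> exp (- c * L' powr \<gamma>)"
    using assms unfolding NLF_def by blast
  show thesis
  proof (rule that[OF c])
    fix n u assume n: "nat \<lceil>L\<rceil> \<le> n" and u: "u \<in> {0..\<beta>}"
    have "L \<le> real n"
      using n by linarith
    then show "\<bar>crossing_prob n u - (1 - theta0 M I u)\<bar> \<le> exp (- c * real n powr \<gamma>)"
      using decay[rule_format, of "real n" u] u crossing_prob_ge[of u n] crossing_prob_le[of u n]
      by auto
  qed
qed

end

section \<open>Differentiability of the percolation function\<close>

theorem theorem0p1:
  fixes M :: "'w measure"
    and I :: "real \<Rightarrow> 'w \<Rightarrow> (int ^ 'd) set"
    and u_star :: real
  assumes "CARD('d) \<ge> 3"
    and "random_interlacements M I"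
    and "critical_level M I u_star"
  shows "\<exists>D. (\<forall>u\<in>{0..<u_hat M I u_star}.
                (theta0 M I has_real_derivative D u) (at u within {0..<u_hat M I u_star})) \<and>
             continuous_on {0..<u_hat M I u_star} D \<and>
             (\<forall>u\<in>{0..<u_hat M I u_star}. D u > 0)"
proof -
  interpret random_interlacements M I
    by (rule assms(2))
  let ?J = "{0..<u_hat M I u_star}"
  obtain F' F'' where
    F': "\<And>n u. 0 \<le> u \<Longrightarrow> (crossing_prob n has_real_derivative F' n u) (at u within {0..})" and
    F'': "\<And>n u. 0 \<le> u \<Longrightarrow> (F' n has_real_derivative F'' n u) (at u within {0..})" and
    F''_bound: "\<And>n u. 0 \<le> u \<Longrightarrow> \<bar>F'' n u\<bar> \<le> 4 * real (2 * n + 1) ^ (2 * CARD('d))" and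
    F'_bound: "\<And>n u. 0 \<le> u \<Longrightarrow> F' n u \<le> - cap {0 :: int ^ 'd} * crossing_prob n u"
    using crossing_prob_derivatives by metis
  define D where "D u = - lim (\<lambda>n. F' n u)" for u
  have "(theta0 M I has_real_derivative D u) (at u within ?J) \<and>
      continuous (at u within ?J) D \<and> 0 < D u" if u: "u \<in> ?J" for u
  proof -
    obtain \<beta> where \<beta>: "u < \<beta>" "\<beta> \<le> u_hat M I u_star" "\<beta> < u_star" "NLF M I 0 \<beta>"
      using u_hat_approximation[OF assms(3), of u] u by auto
    obtain N c \<gamma> where "0 < c" "0 < \<gamma>" and approx:
      "\<And>n u. N \<le> n \<Longrightarrow> u \<in> {0..\<beta>} \<Longrightarrow>
        \<bar>crossing_prob n u - (1 - theta0 M I u)\<bar> \<le> exp (- c * real n powr \<gamma>)"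
      using NLF_crossing_prob[OF \<beta>(4)] by metis
    have "0 < \<beta>" "{0..\<beta>} \<subseteq> {0..}" and u\<beta>: "u \<in> {0..\<beta>}"
      using u \<beta>(1) by auto
    have dF: "(crossing_prob n has_real_derivative F' n x) (at x within {0..\<beta>})"
      "(F' n has_real_derivative F'' n x) (at x within {0..\<beta>})" if "x \<in> {0..\<beta>}" for n x
      using F'[of x n] F''[of x n] that
      by (auto intro: has_field_derivative_subset[OF _ \<open>{0..\<beta>} \<subseteq> {0..}\<close>])
    have dF_bound: "\<bar>F'' n x\<bar> \<le> 4 * real (2 * n + 1) ^ (2 * CARD('d))" if "x \<in> {0..\<beta>}" for n x
      using F''_bound[of x n] that by simp
    have unif: "uniform_limit {0..\<beta>} F' (\<lambda>x. lim (\<lambda>n. F' n x)) sequentially"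
      by (rule C1_limit_of_fast_convergence(1)[where g = crossing_prob and g'' = F'']) fact+
    have deriv: "((\<lambda>u. 1 - theta0 M I u) has_real_derivative lim (\<lambda>n. F' n u)) (at u within {0..\<beta>})"
      by (rule C1_limit_of_fast_convergence(2)[where g = crossing_prob and g'' = F'']) fact+
    (* Derivatives and continuity at u only see a neighbourhood of u, in which {0..\<beta>} and ?J agree. *)
    have at_u: "at u within ?J = at u within {0..\<beta>}"
      by (rule at_within_nhd[of u "{..<\<beta>}"]) (use \<beta> in auto)
    have "(theta0 M I has_real_derivative D u) (at u within {0..\<beta>})"
      using DERIV_diff[OF DERIV_const[of 1] deriv] by (simp add: D_def)
    moreover have "continuous_on {0..\<beta>} D"
    proof -
      have "continuous_on {0..\<beta>} (F' n)" for n
        using dF(2) by (rule DERIV_continuous_on)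
      then have "continuous_on {0..\<beta>} (\<lambda>x. lim (\<lambda>n. F' n x))"
        by (intro uniform_limit_theorem[OF _ unif]) auto
      then show ?thesis
        unfolding D_def by (intro continuous_intros)
    qed
    moreover have "0 < D u"
    proof -
      have "theta0 M I u < 1"
        using assms(3) u \<beta> theta0_at_zero by (cases "u = 0") (auto simp: critical_level_def)
      moreover have "F' n u \<le> - cap {0 :: int ^ 'd} * (1 - theta0 M I u)" for n
        using F'_bound[of u n] mult_left_mono[OF crossing_prob_ge[of u n] cap_nonneg[of "{0 :: int ^ 'd}"]] u
        by simp
      then have "lim (\<lambda>n. F' n u) \<le> - cap {0 :: int ^ 'd} * (1 - theta0 M I u)"
        using tendsto_uniform_limitI[OF unif u\<beta>] by (intro LIMSEQ_le_const2) auto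
      ultimately show ?thesis
        using mult_pos_pos[OF cap_origin_pos[OF assms(3)], of "1 - theta0 M I u"]
        by (simp add: D_def)
    qed
    ultimately show ?thesis
      unfolding at_u using u\<beta> by (auto simp: continuous_on_eq_continuous_within)
  qed
  then show ?thesis
    by (intro exI[of _ D]) (auto simp: continuous_on_eq_continuous_within)
qed

end
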